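(* There is a subcubic outerplanar graph that is not packing $(1,1,2,5)$-colorable. Namely, the subcubic outerplanar graph $G$ defined in the context is not packing $(1,1,2,5)$-colorable.
   Context: A graph is subcubic if its maximum degree is at most $3$. For a non-decreasing sequence $S=(s_1,\dots,s_k)$ of positive integers, a packing $S$-coloring of a graph $G$ is a partition of $V(G)$ into sets $V_1,\dots,V_k$ (some possibly empty) such that, for each $1\le i\le k$, the distance in $G$ between any two distinct vertices $x,y\in V_i$ is at least $s_i+1$. $G$ is packing $S$-colorable if it has a packing $S$-coloring. Construction of $G$. Let $L$ be the graph with vertices $a_1,\dots,a_6$ and edges $a_1a_2, a_1a_3, a_2a_3, a_2a_4, a_3a_5, a_4a_5, a_4a_6, a_5a_6$; call $a_1$ its first vertex and $a_6$ its last vertex. Gadget $G_1$: a root vertex $w$ together with two disjoint copies of $L$, where $w$ is joined by an edge to the first vertex of each copy ($13$ vertices). Gadget $G_2$: start with a root vertex $x_4$ and two disjoint copies of $L$, with $x_4$ joined by an edge to the first vertex of each copy. For each of these two copies of $L$, add a new vertex $p$ joined to the last vertex of that copy, and add two new disjoint copies of $L$, with $p$ joined to the first vertex of each of them. Finally, for each of the four copies of $L$ added in this last step, add a new disjoint copy of $G_1$ and join the last vertex of that copy of $L$ by an edge to the root of that copy of $G_1$. The graph $G$: a triangle $x_1x_2x_3$ and three disjoint copies of $G_2$, one for each $i\in\{1,2,3\}$, with $x_i$ joined by an edge to the root of the $i$-th copy. *)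

theory Defs
  imports "HOL-Analysis.Analysis" "Graph_Theory.Graph_Theory"
begin

text \<open>
  Simple undirected graphs are those of the locale \<^locale>\<open>pair_graph\<close>: finite, loop-free
  and symmetric, so that an edge \<open>uv\<close> is the pair of arcs \<open>(u, v)\<close> and \<open>(v, u)\<close>.
\<close>

text \<open>By symmetry the out-degree of a vertex is its number of neighbours.\<close>

definition subcubic :: "'a pair_pre_digraph \<Rightarrow> bool" where
  "subcubic G \<longleftrightarrow> (\<forall>v \<in> pverts G. out_degree (with_proj G) v \<le> 3)"

definition gdist :: "'a pair_pre_digraph \<Rightarrow> 'a \<Rightarrow> 'a \<Rightarrow> ereal" where
  "gdist G u v = wf_digraph.\<mu> (with_proj G) (\<lambda>_. 1) u v"

text \<open>The classes \<open>V\<^sub>1, \<dots>, V\<^sub>k\<close> are indexed from \<open>0\<close>, like the list \<open>S\<close>.\<close>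

definition packing_coloring ::
    "nat list \<Rightarrow> 'a pair_pre_digraph \<Rightarrow> (nat \<Rightarrow> 'a set) \<Rightarrow> bool" where
  "packing_coloring S G V \<longleftrightarrow>
     (\<Union>i<length S. V i) = pverts G \<and>
     disjoint_family_on V {..<length S} \<and>
     (\<forall>i<length S. \<forall>x\<in>V i. \<forall>y\<in>V i. x \<noteq> y \<longrightarrow> ereal (real (S ! i + 1)) \<le> gdist G x y)"

definition packing_colorable :: "nat list \<Rightarrow> 'a pair_pre_digraph \<Rightarrow> bool" where
  "packing_colorable S G \<longleftrightarrow> (\<exists>V. packing_coloring S G V)"

text \<open>
  A plane drawing places vertex \<open>v\<close> at \<open>p v\<close> and draws the edge \<open>uv\<close> as the simple arc
  \<open>c (u, v)\<close>; the two opposite arcs of an edge have to trace the same curve. An edge meets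
  the drawn vertices only in its ends, and two different edges meet only in common ends.
\<close>

definition plane_drawing ::
    "'a pair_pre_digraph \<Rightarrow> ('a \<Rightarrow> complex) \<Rightarrow> ('a \<times> 'a \<Rightarrow> real \<Rightarrow> complex) \<Rightarrow> bool" where
  "plane_drawing G p c \<longleftrightarrow>
     inj_on p (pverts G) \<and>
     (\<forall>(u, v) \<in> parcs G.
        arc (c (u, v)) \<and> pathstart (c (u, v)) = p u \<and> pathfinish (c (u, v)) = p v \<and>
        path_image (c (v, u)) = path_image (c (u, v)) \<and>
        path_image (c (u, v)) \<inter> p ` pverts G = {p u, p v}) \<and>
     (\<forall>(u, v) \<in> parcs G. \<forall>(x, y) \<in> parcs G. {u, v} \<noteq> {x, y} \<longrightarrow>
        path_image (c (u, v)) \<inter> path_image (c (x, y)) \<subseteq> p ` ({u, v} \<inter> {x, y}))"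

definition drawing_points ::
    "'a pair_pre_digraph \<Rightarrow> ('a \<Rightarrow> complex) \<Rightarrow> ('a \<times> 'a \<Rightarrow> real \<Rightarrow> complex) \<Rightarrow> complex set" where
  "drawing_points G p c = p ` pverts G \<union> (\<Union>e \<in> parcs G. path_image (c e))"

text \<open>For a finite graph, \<open>outside (drawing_points G p c)\<close> is the outer face of the drawing.\<close>

definition outerplanar :: "'a pair_pre_digraph \<Rightarrow> bool" where
  "outerplanar G \<longleftrightarrow>
     (\<exists>p c. plane_drawing G p c \<and>
        (\<forall>v \<in> pverts G. p v \<in> frontier (outside (drawing_points G p c))))"

text \<open>
  The edge sets below contain one orientation of each edge. A \<^typ>\<open>bool\<close> argument of a
  constructor says to which of two copies a vertex belongs.
\<close>

datatype L_vert = A1 | A2 | A3 | A4 | A5 | A6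

definition L_edges :: "(L_vert \<times> L_vert) set" where
  "L_edges = {(A1, A2), (A1, A3), (A2, A3), (A2, A4), (A3, A5), (A4, A5), (A4, A6), (A5, A6)}"

datatype G1_vert = W | L1 bool L_vert

definition G1_edges :: "(G1_vert \<times> G1_vert) set" where
  "G1_edges =
     {(W, L1 b A1) | b. True} \<union>
     {(L1 b u, L1 b v) | b u v. (u, v) \<in> L_edges}"

text \<open>
  \<open>Mid b\<close> is the vertex \<open>p\<close> attached to the upper copy \<open>Upper b\<close> of \<open>L\<close>. Below it hang
  the lower copies \<open>Lower b d\<close> of \<open>L\<close>, each followed by the copy \<open>End b d\<close> of \<open>G\<^sub>1\<close>.
\<close>

datatype G2_vert = X4 | Upper bool L_vert | Mid bool | Lower bool bool L_vert | End bool bool G1_vert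

definition G2_edges :: "(G2_vert \<times> G2_vert) set" where
  "G2_edges =
     {(X4, Upper b A1) | b. True} \<union>
     {(Upper b u, Upper b v) | b u v. (u, v) \<in> L_edges} \<union>
     {(Upper b A6, Mid b) | b. True} \<union>
     {(Mid b, Lower b d A1) | b d. True} \<union>
     {(Lower b d u, Lower b d v) | b d u v. (u, v) \<in> L_edges} \<union>
     {(Lower b d A6, End b d W) | b d. True} \<union>
     {(End b d u, End b d v) | b d u v. (u, v) \<in> G1_edges}"

datatype tri = T1 | T2 | T3

datatype G_vert = Tri tri | Branch tri G2_vert

definition G_edges :: "(G_vert \<times> G_vert) set" where
  "G_edges =
     {(Tri T1, Tri T2), (Tri T2, Tri T3), (Tri T1, Tri T3)} \<union>
     {(Tri i, Branch i X4) | i. True} \<union>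
     {(Branch i u, Branch i v) | i u v. (u, v) \<in> G2_edges}"

definition graph_G :: "G_vert pair_pre_digraph" where
  "graph_G = \<lparr> pverts = UNIV, parcs = G_edges \<union> G_edges\<inverse> \<rparr>"

end

theory Submission
  imports Defs
begin

text \<open>
  Colouring. Call the classes \<open>0\<close>, \<open>1\<close>, \<open>2\<close>, \<open>3\<close>. A copy of \<open>L\<close> without colour \<open>3\<close> has
  colour \<open>2\<close> at both ends, so of two copies of \<open>L\<close> hanging from one vertex at least one contains
  colour \<open>3\<close>. Since equal colours \<open>3\<close> are at distance at least \<open>6\<close>, a \<open>3\<close> in every end gadget
  \<open>G\<^sub>1\<close> forces a \<open>3\<close> within distance \<open>3\<close> below each middle vertex, and this in turn forces every
  \<open>3\<close> in an upper copy of \<open>L\<close> to lie within distance \<open>2\<close> of \<open>x\<^sub>4\<close>. So exactly one of the two upper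
  copies contains a \<open>3\<close>, and the first vertex of the other has colour \<open>2\<close>. Hence the neighbour
  of \<open>x\<^sub>4\<close> in the central triangle has neither colour \<open>2\<close> nor \<open>3\<close>, and two colours do not suffice
  for a triangle.

  Outerplanarity. The vertices can be put in a linear order in which no two edges interleave; put
  them in this order on a parabola and draw the edges as chords.
\<close>

section \<open>Chords of a parabola\<close>

text \<open>An arc with \<open>b \<le> a\<close> imposes nothing in the first place. On a symmetric
  relation both ends of the other edge are tested.\<close>

definition noncrossing :: "('b::linorder \<times> 'b) set \<Rightarrow> bool" where
  "noncrossing E \<longleftrightarrow>
     (\<forall>(a, b) \<in> E. \<forall>(c, d) \<in> E. a < c \<and> c < b \<longrightarrow> a \<le> d \<and> d \<le> b)"

lemma noncrossing_subset: "noncrossing F \<Longrightarrow> E \<subseteq> F \<Longrightarrow> noncrossing E"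
  unfolding noncrossing_def split_def by blast

definition parabola :: "real \<Rightarrow> complex" where
  "parabola t = Complex t (t\<^sup>2)"

lemma inj_parabola: "inj parabola"
  by (auto simp: inj_def parabola_def)

text \<open>The line through the two points has height \<open>(a + b) x - a b\<close> and so exceeds
  \<open>x\<^sup>2\<close> by \<open>(x - a) (b - x)\<close>. This product decides all incidence
  questions about chords.\<close>

lemma parabola_chord:
  assumes "z \<in> closed_segment (parabola a) (parabola b)" "a \<le> b"
  shows "a \<le> Re z" "Re z \<le> b" "Im z = (Re z)\<^sup>2 + (Re z - a) * (b - Re z)"
proof -
  obtain u where u: "0 \<le> u" "u \<le> 1" "z = (1 - u) *\<^sub>R parabola a + u *\<^sub>R parabola b"
    using assms(1) by (auto simp: closed_segment_def)
  have re: "Re z = a + u * (b - a)" and im: "Im z = (1 - u) * a\<^sup>2 + u * b\<^sup>2"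
    by (simp_all add: u(3) parabola_def algebra_simps)
  show "a \<le> Re z" using re u(1) assms(2) by simp
  have "u * (b - a) \<le> 1 * (b - a)" using u(2) assms(2) by (intro mult_right_mono) auto
  then show "Re z \<le> b" using re by simp
  show "Im z = (Re z)\<^sup>2 + (Re z - a) * (b - Re z)"
    unfolding re im by (simp add: power2_eq_square algebra_simps)
qed

lemma parabola_chord_above:
  assumes "z \<in> closed_segment (parabola a) (parabola b)"
  shows "(Re z)\<^sup>2 \<le> Im z"
proof (cases "a \<le> b")
  case True
  with parabola_chord[OF assms] show ?thesis by simp
next
  case False
  then have "b \<le> a" by simp
  with parabola_chord[of z b a] assms show ?thesis by (simp add: closed_segment_commute)
qed

lemma parabola_mem_chord:
  assumes "parabola t \<in> closed_segment (parabola a) (parabola b)"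
  shows "t = a \<or> t = b"
proof (cases "a \<le> b")
  case True
  with parabola_chord[OF assms] show ?thesis by (auto simp: parabola_def)
next
  case False
  then have "b \<le> a" by simp
  with parabola_chord[of "parabola t" b a] assms show ?thesis
    by (auto simp: closed_segment_commute parabola_def)
qed

text \<open>Widening the interval raises the excess \<open>(x - a) (b - x)\<close> over the
  parabola. Equality at a common point forces that point to be a shared end.\<close>

lemma parabola_chords_Int_nested:
  assumes z: "z \<in> closed_segment (parabola a) (parabola b)"
      "z \<in> closed_segment (parabola c) (parabola d)"
    and le: "a < b" "c \<le> a" "b \<le> d" and ne: "a \<noteq> c \<or> b \<noteq> d"
  shows "z \<in> parabola ` ({a, b} \<inter> {c, d})"
proof -
  let ?x = "Re z"
  have x: "a \<le> ?x" "?x \<le> b" and i1: "Im z = ?x\<^sup>2 + (?x - a) * (b - ?x)"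
    using parabola_chord[OF z(1)] le by auto
  have i2: "Im z = ?x\<^sup>2 + (?x - c) * (d - ?x)"
    using parabola_chord[OF z(2)] le by auto
  have eq: "(?x - a) * (b - ?x) = (?x - c) * (d - ?x)" using i1 i2 by simp
  have "?x = a \<and> a = c \<or> ?x = b \<and> b = d"
  proof (rule ccontr)
    assume n: "\<not> ?thesis"
    \<comment> \<open>The interval is widened at one end at a time; each of the two resulting
      equalities has a common factor to cancel.\<close>
    have m1: "(?x - a) * (b - ?x) \<le> (?x - a) * (d - ?x)" using x le by (intro mult_left_mono) auto
    have m2: "(?x - a) * (d - ?x) \<le> (?x - c) * (d - ?x)" using x le by (intro mult_right_mono) auto
    have "(?x - a) * (b - ?x) = (?x - a) * (d - ?x)" "(?x - a) * (d - ?x) = (?x - c) * (d - ?x)"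
      using m1 m2 eq by auto
    then have "(?x = a \<or> b = d) \<and> (d = ?x \<or> a = c)" by auto
    with n ne x le show False by auto
  qed
  moreover have "z = parabola ?x" if "?x = a \<or> ?x = b"
    using i1 that by (auto simp: parabola_def complex_eq_iff)
  ultimately show ?thesis by (auto simp del: insert_iff intro!: image_eqI[of z parabola ?x])
qed

lemma parabola_chords_Int_ordered:
  assumes z: "z \<in> closed_segment (parabola a) (parabola b)"
      "z \<in> closed_segment (parabola c) (parabola d)"
    and less: "a < b" "c < d" and ne: "a \<noteq> c \<or> b \<noteq> d"
    and nc: "\<not> (a < c \<and> c < b \<and> b < d)" "\<not> (c < a \<and> a < d \<and> d < b)"
  shows "z \<in> parabola ` ({a, b} \<inter> {c, d})"
proof -
  let ?x = "Re z"
  note x = parabola_chord[OF z(1)] parabola_chord[OF z(2)]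
  \<comment> \<open>Intervals that do not interleave are nested or have disjoint interiors; in the
    latter case only a touching end can be shared.\<close>
  consider "c \<le> a" "b \<le> d" | "a \<le> c" "d \<le> b" | "b \<le> c" | "d \<le> a"
    using nc less by linarith
  then show ?thesis
  proof cases
    case 1
    show ?thesis using parabola_chords_Int_nested[OF z less(1) 1 ne] .
  next
    case 2
    show ?thesis using parabola_chords_Int_nested[OF z(2,1) less(2) 2] ne
      by (metis Int_commute)
  next
    case 3
    then have "?x = b" "b = c" using x less by auto
    then have "z = parabola b" using x less by (auto simp: parabola_def complex_eq_iff)
    with \<open>b = c\<close> show ?thesis by auto
  next
    case 4
    then have "?x = a" "a = d" using x less by auto
    then have "z = parabola a" using x less by (auto simp: parabola_def complex_eq_iff)
    with \<open>a = d\<close> show ?thesis by auto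
  qed
qed

lemma parabola_chords_Int:
  assumes z: "z \<in> closed_segment (parabola a) (parabola b)"
      "z \<in> closed_segment (parabola c) (parabola d)"
    and ne: "a \<noteq> b" "c \<noteq> d" "{a, b} \<noteq> {c, d}"
    and nc: "noncrossing {(a, b), (b, a), (c, d), (d, c)}"
  shows "z \<in> parabola ` ({a, b} \<inter> {c, d})"
proof -
  have z': "z \<in> closed_segment (parabola b) (parabola a)"
      "z \<in> closed_segment (parabola d) (parabola c)"
    using z by (simp_all only: closed_segment_commute[of "parabola b"] closed_segment_commute[of "parabola d"])
  have ne': "a \<noteq> c \<or> b \<noteq> d" "a \<noteq> d \<or> b \<noteq> c" "b \<noteq> c \<or> a \<noteq> d" "b \<noteq> d \<or> a \<noteq> c"
    using ne(3) by blast+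
  have N: "\<not> (s < u \<and> u < t \<and> t < v)" "\<not> (u < s \<and> s < v \<and> v < t)"
    if "(s, t) = (a, b) \<or> (s, t) = (b, a)" "(u, v) = (c, d) \<or> (u, v) = (d, c)" for s t u v
  proof -
    let ?E = "{(a, b), (b, a), (c, d), (d, c)}"
    have "(s, t) \<in> ?E" "(u, v) \<in> ?E" "(v, u) \<in> ?E" using that by auto
    then have "s < u \<and> u < t \<longrightarrow> v \<le> t" "s < v \<and> v < t \<longrightarrow> s \<le> u"
      using nc unfolding noncrossing_def by blast+
    then show "\<not> (s < u \<and> u < t \<and> t < v)" "\<not> (u < s \<and> s < v \<and> v < t)" by auto
  qed
  consider "a < b" "c < d" | "a < b" "d < c" | "b < a" "c < d" | "b < a" "d < c"
    using ne(1,2) by linarith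
  then show ?thesis
  proof cases
    case 1
    show ?thesis
      by (rule parabola_chords_Int_ordered[OF z 1 ne'(1) N]) simp_all
  next
    case 2
    have "z \<in> parabola ` ({a, b} \<inter> {d, c})"
      by (rule parabola_chords_Int_ordered[OF z(1) z'(2) 2 ne'(2) N]) simp_all
    then show ?thesis by (simp only: insert_commute)
  next
    case 3
    have "z \<in> parabola ` ({b, a} \<inter> {c, d})"
      by (rule parabola_chords_Int_ordered[OF z'(1) z(2) 3 ne'(3) N]) simp_all
    then show ?thesis by (simp only: insert_commute)
  next
    case 4
    have "z \<in> parabola ` ({b, a} \<inter> {d, c})"
      by (rule parabola_chords_Int_ordered[OF z'(1) z'(2) 4 ne'(4) N]) simp_all
    then show ?thesis by (simp only: insert_commute)
  qed
qed

text \<open>The vertical ray below the vertex avoids the drawing.\<close>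

lemma parabola_mem_frontier_outside:
  assumes above: "\<And>z. z \<in> S \<Longrightarrow> (Re z)\<^sup>2 \<le> Im z" and "parabola t \<in> S"
  shows "parabola t \<in> frontier (outside S)"
proof -
  define R where "R = {z. Re z = t \<and> Im z < t\<^sup>2}"
  have "convex R"
  proof -
    have "convex ({z::complex. inner 1 z = t} \<inter> {z. inner \<i> z < t\<^sup>2})"
      by (intro convex_Int convex_hyperplane convex_halfspace_lt)
    then show ?thesis by (simp add: R_def Collect_conj_eq inner_complex_def)
  qed
  then have "Topological_Spaces.connected R" by (rule convex_connected)
  have R: "R \<subseteq> - S" using above by (fastforce simp: R_def)
  have unb: "\<not> bounded R"
  proof
    assume "bounded R"
    then obtain B where B: "\<And>z. z \<in> R \<Longrightarrow> norm z \<le> B" by (auto simp: bounded_iff)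
    have "Complex t (- \<bar>B\<bar> - 1) \<in> R"
      by (simp add: R_def) (smt (verit) zero_le_power2)
    then have "norm (Complex t (- \<bar>B\<bar> - 1)) \<le> B" by (rule B)
    with abs_Im_le_cmod[of "Complex t (- \<bar>B\<bar> - 1)"] show False by simp
  qed
  \<comment> \<open>The connected unbounded ray lies in a single component of the complement, which
    is therefore unbounded.\<close>
  have out: "R \<subseteq> outside S"
  proof
    fix z assume z: "z \<in> R"
    then have "R \<subseteq> connected_component_set (- S) z"
      using \<open>Topological_Spaces.connected R\<close> R by (intro connected_component_maximal)
    then show "z \<in> outside S"
      using unb bounded_subset z R by (auto simp: outside_def)
  qed
  have "parabola t \<in> closure R"
  proof (rule closure_sequential[THEN iffD2], intro exI conjI allI)
    fix n show "Complex t (t\<^sup>2 - 1 / real (Suc n)) \<in> R" by (simp add: R_def)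
    have "(\<lambda>n. t\<^sup>2 - 1 / real (Suc n)) \<longlonglongrightarrow> t\<^sup>2 - 0"
      by (intro tendsto_diff tendsto_const LIMSEQ_Suc lim_1_over_n)
    then show "(\<lambda>n. Complex t (t\<^sup>2 - 1 / real (Suc n))) \<longlonglongrightarrow> parabola t"
      unfolding parabola_def by (intro tendsto_Complex tendsto_const) simp
  qed
  then have "parabola t \<in> closure (outside S)" using closure_mono[OF out] by blast
  moreover have "parabola t \<notin> interior (outside S)"
    using assms(2) interior_subset[of "outside S"] outside_no_overlap[of S] by blast
  ultimately show ?thesis by (simp add: frontier_def)
qed

section \<open>From a linear order to an outerplanar drawing\<close>

text \<open>Straight chords give the drawing: noncrossing edges meet only in common ends, and since
  nothing is drawn below the parabola, every vertex is on the boundary of the outer face.\<close>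

lemma outerplanar_if_noncrossing:
  fixes pos :: "'a \<Rightarrow> nat"
  assumes "pair_graph G" and inj: "inj_on pos (pverts G)"
    and nc: "noncrossing (map_prod pos pos ` parcs G)"
  shows "outerplanar G"
proof -
  interpret pair_graph G by fact
  define r where "r = (\<lambda>v. real (pos v))"
  define p where "p = (\<lambda>v. parabola (r v))"
  define c where "c = (\<lambda>(u, v). linepath (p u) (p v))"
  have r_eq: "r u = r v \<longleftrightarrow> u = v" if "u \<in> pverts G" "v \<in> pverts G" for u v
    using inj that by (auto simp: r_def inj_on_def)
  have p_eq: "p u = p v \<longleftrightarrow> u = v" if "u \<in> pverts G" "v \<in> pverts G" for u v
    using r_eq[OF that] inj_parabola by (auto simp: p_def inj_def)
  have sym: "(v, u) \<in> parcs G" if "(u, v) \<in> parcs G" for u v using that by (rule arcs_symmetric)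
  note V = in_arcsD1 in_arcsD2
  have ne: "u \<noteq> v" if "(u, v) \<in> parcs G" for u v using no_loops'[OF that] .
  have vert: "path_image (c (u, v)) \<inter> p ` pverts G = {p u, p v}" if e: "(u, v) \<in> parcs G" for u v
  proof -
    have "w = u \<or> w = v" if "w \<in> pverts G" "p w \<in> closed_segment (p u) (p v)" for w
      using parabola_mem_chord[of "r w" "r u" "r v"] that V[OF e] r_eq by (auto simp: p_def)
    then show ?thesis using V[OF e] by (auto simp: c_def)
  qed
  have cross: "path_image (c (u, v)) \<inter> path_image (c (x, y)) \<subseteq> p ` ({u, v} \<inter> {x, y})"
    if e: "(u, v) \<in> parcs G" "(x, y) \<in> parcs G" "{u, v} \<noteq> {x, y}" for u v x y
  proof
    fix z assume z: "z \<in> path_image (c (u, v)) \<inter> path_image (c (x, y))"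
    have "z \<in> parabola ` ({r u, r v} \<inter> {r x, r y})"
    proof (rule parabola_chords_Int)
      show "z \<in> closed_segment (parabola (r u)) (parabola (r v))"
          "z \<in> closed_segment (parabola (r x)) (parabola (r y))"
        using z by (auto simp: c_def p_def)
      show "r u \<noteq> r v" "r x \<noteq> r y" using e V ne r_eq by metis+
      show "{r u, r v} \<noteq> {r x, r y}"
        using e(3) r_eq V[OF e(1)] V[OF e(2)] by (auto simp: doubleton_eq_iff)
      show "noncrossing {(r u, r v), (r v, r u), (r x, r y), (r y, r x)}"
      proof -
        have "{(u, v), (v, u), (x, y), (y, x)} \<subseteq> parcs G" using e sym by auto
        then have "noncrossing (map_prod pos pos ` {(u, v), (v, u), (x, y), (y, x)})"
          using noncrossing_subset[OF nc image_mono] by blast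
        then show ?thesis by (simp add: noncrossing_def r_def)
      qed
    qed
    then show "z \<in> p ` ({u, v} \<inter> {x, y})"
      using r_eq V[OF e(1)] V[OF e(2)] by (auto simp: p_def)
  qed
  have "plane_drawing G p c"
    unfolding plane_drawing_def
  proof (intro conjI)
    show "inj_on p (pverts G)" using p_eq by (auto simp: inj_on_def)
    show "\<forall>(u, v) \<in> parcs G. Path_Connected.arc (c (u, v)) \<and> pathstart (c (u, v)) = p u \<and>
        pathfinish (c (u, v)) = p v \<and> path_image (c (v, u)) = path_image (c (u, v)) \<and>
        path_image (c (u, v)) \<inter> p ` pverts G = {p u, p v}"
    proof safe
      fix u v assume e: "(u, v) \<in> parcs G"
      show "Path_Connected.arc (c (u, v))" using p_eq ne[OF e] V[OF e] by (auto simp: c_def intro: arc_linepath)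
    qed (use vert in \<open>auto simp: c_def closed_segment_commute\<close>)
    show "\<forall>(u, v) \<in> parcs G. \<forall>(x, y) \<in> parcs G. {u, v} \<noteq> {x, y} \<longrightarrow>
        path_image (c (u, v)) \<inter> path_image (c (x, y)) \<subseteq> p ` ({u, v} \<inter> {x, y})"
      using cross by blast
  qed
  moreover have "p v \<in> frontier (outside (drawing_points G p c))" if "v \<in> pverts G" for v
  proof -
    have "parabola (r v) \<in> frontier (outside (drawing_points G p c))"
    proof (rule parabola_mem_frontier_outside)
      show "parabola (r v) \<in> drawing_points G p c" using that by (auto simp: drawing_points_def p_def)
      fix z assume "z \<in> drawing_points G p c"
      then consider v where "z = p v" | u v where "z \<in> closed_segment (p u) (p v)"
        by (auto simp: drawing_points_def c_def)
      then show "(Re z)\<^sup>2 \<le> Im z"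
        by cases (auto simp: p_def parabola_def intro: parabola_chord_above)
    qed
    then show ?thesis by (simp add: p_def)
  qed
  ultimately show ?thesis unfolding outerplanar_def by blast
qed

section \<open>A linear order without interleaving edges\<close>

text \<open>A one-page book embedding with spine \<open>0, ..., n - 1\<close>: vertices on a line,
  all edges on one side of it.\<close>

definition page :: "nat \<Rightarrow> nat rel \<Rightarrow> bool" where
  "page n E \<longleftrightarrow> noncrossing E \<and> sym E \<and> E \<subseteq> {..<n} \<times> {..<n}"

text \<open>The copy of \<open>F\<close> at \<open>r\<close> shares its vertex \<open>0\<close> with the stretched \<open>E\<close>.\<close>

definition graft :: "nat \<Rightarrow> nat rel \<Rightarrow> nat set \<Rightarrow> nat rel \<Rightarrow> nat rel" where
  "graft K E R F = {(K * a, K * b) | a b. (a, b) \<in> E} \<union>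
     {(K * r + a, K * r + b) | r a b. r \<in> R \<and> (a, b) \<in> F}"

lemma graft_base: "(a, b) \<in> E \<Longrightarrow> (K * a, K * b) \<in> graft K E R F"
  unfolding graft_def by blast

lemma graft_copy: "r \<in> R \<Longrightarrow> (a, b) \<in> F \<Longrightarrow> (K * r + a, K * r + b) \<in> graft K E R F"
  unfolding graft_def by blast

lemma digit_less_iff:
  fixes K :: nat
  assumes "s < K"
  shows "K * a < K * r + s \<longleftrightarrow> a < r \<or> a = r \<and> 0 < s" "K * r + s < K * b \<longleftrightarrow> r < b"
proof -
  show "K * a < K * r + s \<longleftrightarrow> a < r \<or> a = r \<and> 0 < s"
  proof (cases "a \<le> r")
    case True
    then obtain d where "r = a + d" using le_Suc_ex by blast
    then show ?thesis using assms by (cases d) (auto simp: algebra_simps)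
  next
    case False
    then obtain d where "a = r + Suc d" using less_imp_Suc_add by fastforce
    then show ?thesis using assms by (auto simp: algebra_simps)
  qed
  show "K * r + s < K * b \<longleftrightarrow> r < b"
  proof (cases "b \<le> r")
    case True
    then obtain d where "r = b + d" using le_Suc_ex by blast
    then show ?thesis by (auto simp: algebra_simps)
  next
    case False
    then obtain d where "b = r + Suc d" using less_imp_Suc_add by fastforce
    then show ?thesis using assms by (auto simp: algebra_simps)
  qed
qed

lemma digit_less_digit:
  fixes K :: nat
  assumes "s < K" "t < K"
  shows "K * q + s < K * r + t \<longleftrightarrow> q < r \<or> q = r \<and> s < t"
proof (cases "q < r")
  case True
  then have "K * Suc q \<le> K * r" by (intro mult_le_mono2) simp
  then show ?thesis using True assms by simp
next
  case False
  show ?thesis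
  proof (cases "q = r")
    case False
    with \<open>\<not> q < r\<close> have "K * Suc r \<le> K * q" by (intro mult_le_mono2) simp
    then show ?thesis using False \<open>\<not> q < r\<close> assms by simp
  qed simp
qed

lemma noncrossingD:
  assumes "noncrossing E" "(a, b) \<in> E" "(c, d) \<in> E" "a < c" "c < b"
  shows "a \<le> d" "d \<le> b"
  using assms unfolding noncrossing_def by blast+

text \<open>Each copy of \<open>F\<close> lives in a block of \<open>K\<close> consecutive
  positions, and stretched arcs of \<open>E\<close> end only at left ends of blocks. Hence a block
  lies entirely under or entirely beside such an arc.\<close>

lemma page_graft:
  assumes E: "page n E" and F: "page K F" and R: "R \<subseteq> {..<n}" and "0 < K"
  shows "page (K * n) (graft K E R F)"
proof -
  have less: "a < K" "b < K" if "(a, b) \<in> F" for a b using F that by (auto simp: page_def)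
  have nE: "noncrossing E" and nF: "noncrossing F" using E F by (auto simp: page_def)
  have "a \<le> d \<and> d \<le> b"
    if ab: "(a, b) \<in> graft K E R F" and cd: "(c, d) \<in> graft K E R F" and acb: "a < c" "c < b"
    for a b c d
  proof -
    from ab consider (E) a' b' where "a = K * a'" "b = K * b'" "(a', b') \<in> E"
      | (F) r a' b' where "a = K * r + a'" "b = K * r + b'" "(a', b') \<in> F"
      unfolding graft_def by blast
    then show ?thesis
    proof cases
      case ab: E
      from cd consider (E) c' d' where "c = K * c'" "d = K * d'" "(c', d') \<in> E"
        | (F) r c' d' where "c = K * r + c'" "d = K * r + d'" "(c', d') \<in> F"
        unfolding graft_def by blast
      then show ?thesis
      proof cases
        case cd: E
        then have "a' < c'" "c' < b'" using acb ab by auto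
        then show ?thesis using noncrossingD[OF nE ab(3) cd(3)] ab cd by auto
      next
        case cd: F
        \<comment> \<open>A copy with an end strictly under the stretched arc has its whole block
          between the ends of that arc.\<close>
        have "a' \<le> r" "r < b'" using acb less[OF cd(3)] unfolding ab cd digit_less_iff[OF less(1)[OF cd(3)]]
          by auto
        then have "K * a' \<le> K * r" "K * Suc r \<le> K * b'" by (intro mult_le_mono2; simp)+
        then show ?thesis using less[OF cd(3)]
          unfolding ab(1,2) cd(1,2) mult_Suc_right by linarith
      qed
    next
      case ab: F
      from cd consider (E) c' d' where "c = K * c'" "d = K * d'" "(c', d') \<in> E"
        | (F) r c' d' where "c = K * r + c'" "d = K * r + d'" "(c', d') \<in> F"
        unfolding graft_def by blast
      then show ?thesis
      proof cases
        case cd: E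
        \<comment> \<open>No multiple of \<open>K\<close> lies strictly between two positions of one
          block.\<close>
        have "r < c'" "c' \<le> r" using acb
          unfolding ab cd digit_less_iff[OF less(1)[OF ab(3)]] digit_less_iff[OF less(2)[OF ab(3)]] by auto
        then show ?thesis by simp
      next
        case cd: (F q)
        note l = less[OF ab(3)] less[OF cd(3)]
        have "r = q" "a' < c'" "c' < b'" using acb
          unfolding ab cd digit_less_digit[OF l(1,3)] digit_less_digit[OF l(3,2)] by auto
        then show ?thesis using noncrossingD[OF nF ab(3) cd(3)] ab cd by simp
      qed
    qed
  qed
  then have "noncrossing (graft K E R F)" unfolding noncrossing_def by blast
  moreover have "sym (graft K E R F)"
    using E F unfolding page_def sym_def graft_def by blast
  moreover have "graft K E R F \<subseteq> {..<K * n} \<times> {..<K * n}"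
  proof -
    have "K * a < K * n" if "a < n" for a using that \<open>0 < K\<close> by simp
    moreover have "K * r + a < K * n" if "r \<in> R" "a < K" for r a
      using that R by (auto simp: digit_less_iff)
    ultimately show ?thesis using E less unfolding graft_def page_def by blast
  qed
  ultimately show ?thesis by (simp add: page_def)
qed

section \<open>Positions for \<open>L\<close> and for two copies hanging from a root\<close>

text \<open>The order follows the cycle \<open>A1 A2 A4 A6 A5 A3\<close>; the other two edges
  \<open>A2 A3\<close> and \<open>A4 A5\<close> become nested chords, from 1 to 5 and from 2 to
  4.\<close>

fun L_pos :: "L_vert \<Rightarrow> nat" where
  "L_pos A1 = 0" | "L_pos A2 = 1" | "L_pos A4 = 2" | "L_pos A6 = 3" | "L_pos A5 = 4" | "L_pos A3 = 5"

text \<open>Position 0 is kept for the graft point and 1 for the root; the copies occupy 2 to 7 and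
  8 to 13.\<close>

definition fork_pos :: "bool \<Rightarrow> L_vert \<Rightarrow> nat" where
  "fork_pos b x = 2 + 6 * of_bool b + L_pos x"

text \<open>
  \<open>L\<close> is drawn along its Hamiltonian cycle. In \<open>planted_fork\<close> the root \<open>1\<close> of two copies of \<open>L\<close>
  is joined to a vertex \<open>0\<close>, at which the page can be grafted.
\<close>

definition planted_fork :: "nat rel" where
  "planted_fork =
     (let E = insert (0, 1) (\<Union>b. insert (1, fork_pos b A1) (map_prod (fork_pos b) (fork_pos b) ` L_edges))
      in E \<union> prod.swap ` E)"

lemma planted_fork_root: "(0, 1) \<in> planted_fork" "(1, fork_pos b A1) \<in> planted_fork"
  unfolding planted_fork_def Let_def by blast+

lemma planted_fork_L: "(x, y) \<in> L_edges \<Longrightarrow> (fork_pos b x, fork_pos b y) \<in> planted_fork"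
  unfolding planted_fork_def Let_def
  using map_prod_imageI[of x y L_edges "fork_pos b" "fork_pos b"] by blast

lemma page_planted_fork: "page 14 planted_fork"
proof -
  have sym: "sym planted_fork"
    unfolding planted_fork_def Let_def by (rule symI) (elim UnE imageE; force)
  \<comment> \<open>All 19 edges in both orientations, with numerals in place of
    \<open>fork_pos\<close>, turn the claim into a finite check.\<close>
  let ?E = "{(0, 1), (1, 2), (2, 3), (2, 7), (3, 7), (3, 4), (6, 7), (4, 6), (4, 5), (5, 6),
      (1, 8), (8, 9), (8, 13), (9, 13), (9, 10), (12, 13), (10, 12), (10, 11), (11, 12),
      (1, 0), (2, 1), (3, 2), (7, 2), (7, 3), (4, 3), (7, 6), (6, 4), (5, 4), (6, 5),
      (8, 1), (9, 8), (13, 8), (13, 9), (10, 9), (13, 12), (12, 10), (11, 10), (12, 11)} :: nat rel"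
  have sub: "planted_fork \<subseteq> ?E"
    by (simp add: planted_fork_def L_edges_def fork_pos_def UNIV_bool)
  have "noncrossing ?E" by (simp add: noncrossing_def)
  then have "noncrossing planted_fork" using sub by (rule noncrossing_subset)
  moreover have "?E \<subseteq> {..<14} \<times> {..<14}" by simp
  then have "planted_fork \<subseteq> {..<14} \<times> {..<14}" using sub by (rule order_trans[rotated])
  ultimately show ?thesis using sym by (simp add: page_def)
qed

definition fork_ends :: "nat set" where
  "fork_ends = {fork_pos False A6, fork_pos True A6}"

lemma fork_pos_A6: "fork_pos b A6 \<in> fork_ends"
  by (cases b) (auto simp: fork_ends_def)

text \<open>The block sizes are \<open>14 ^ 3 = 2744\<close>, \<open>14 ^ 2 = 196\<close> and 14.
  Each triangle vertex carries three nested levels of forks, every deeper level glued at the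
  \<open>A6\<close> vertices of the previous one. The arc from 0 to 1 of a fork becomes the edge
  from the gluing vertex to its root.\<close>

definition G_page :: "nat rel" where
  "G_page = graft 2744 {(i, j). i < 3 \<and> j < 3 \<and> i \<noteq> j} {..<3}
     (graft 196 planted_fork fork_ends (graft 14 planted_fork fork_ends planted_fork))"

lemma page_G_page: "page 8232 G_page"
proof -
  have R: "fork_ends \<subseteq> {..<14}" by (simp add: fork_ends_def fork_pos_def)
  have T: "page 3 {(i, j). i < 3 \<and> j < 3 \<and> i \<noteq> j}"
    by (auto simp: page_def noncrossing_def sym_def)
  note P = page_planted_fork
  have "page 196 (graft 14 planted_fork fork_ends planted_fork)"
    using page_graft[OF P P R] by simp
  from page_graft[OF P this R] page_graft[OF T, of 2744] show ?thesis by (simp add: G_page_def)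
qed

section \<open>Positions of the vertices of the whole graph\<close>

fun tri_pos :: "tri \<Rightarrow> nat" where
  "tri_pos T1 = 0" | "tri_pos T2 = 1" | "tri_pos T3 = 2"

fun G1_pos :: "G1_vert \<Rightarrow> nat" where
  "G1_pos W = 1" | "G1_pos (L1 b x) = fork_pos b x"

text \<open>The factors \<open>* 1\<close> keep positions in the shape that
  \<open>graft_base\<close> and \<open>graft_copy\<close> produce, so that edges match
  syntactically.\<close>

fun G_pos :: "G_vert \<Rightarrow> nat" where
  "G_pos (Tri i) = 2744 * tri_pos i"
| "G_pos (Branch i X4) = 2744 * tri_pos i + 196 * 1"
| "G_pos (Branch i (Upper b x)) = 2744 * tri_pos i + 196 * fork_pos b x"
| "G_pos (Branch i (Mid b)) = 2744 * tri_pos i + (196 * fork_pos b A6 + 14 * 1)"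
| "G_pos (Branch i (Lower b d x)) = 2744 * tri_pos i + (196 * fork_pos b A6 + 14 * fork_pos d x)"
| "G_pos (Branch i (End b d v)) =
     2744 * tri_pos i + (196 * fork_pos b A6 + (14 * fork_pos d A6 + G1_pos v))"

lemma tri_pos_less: "tri_pos i < 3" by (cases i) auto

lemma G_edges_cases [consumes 1]:
  assumes "(u, v) \<in> G_edges"
  obtains
      (tri) i j where "u = Tri i" "v = Tri j" "i \<noteq> j"
    | (root) i where "u = Tri i" "v = Branch i X4"
    | (fork) i b where "u = Branch i X4" "v = Branch i (Upper b A1)"
    | (upper) i b x y where "u = Branch i (Upper b x)" "v = Branch i (Upper b y)" "(x, y) \<in> L_edges"
    | (mid) i b where "u = Branch i (Upper b A6)" "v = Branch i (Mid b)"
    | (mid_fork) i b d where "u = Branch i (Mid b)" "v = Branch i (Lower b d A1)"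
    | (lower) i b d x y where "u = Branch i (Lower b d x)" "v = Branch i (Lower b d y)" "(x, y) \<in> L_edges"
    | (end_root) i b d where "u = Branch i (Lower b d A6)" "v = Branch i (End b d W)"
    | (end_fork) i b d e where "u = Branch i (End b d W)" "v = Branch i (End b d (L1 e A1))"
    | (end_L) i b d e x y where "u = Branch i (End b d (L1 e x))" "v = Branch i (End b d (L1 e y))"
        "(x, y) \<in> L_edges"
  using assms unfolding G_edges_def G2_edges_def G1_edges_def by (elim UnE) auto

text \<open>Every edge sits at one level of the nested graft: \<open>l1\<close>, \<open>l2\<close>,
  \<open>l3\<close> descend into a branch, a lower fork and an end fork, while \<open>b2\<close> and
  \<open>b3\<close> pick the stretched part.\<close>

lemma G_pos_edge:
  assumes "(u, v) \<in> G_edges" shows "(G_pos u, G_pos v) \<in> G_page"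
proof -
  let ?P1 = "graft 14 planted_fork fork_ends planted_fork"
  let ?P2 = "graft 196 planted_fork fork_ends ?P1"
  have l1: "(2744 * tri_pos i + a, 2744 * tri_pos i + b) \<in> G_page" if "(a, b) \<in> ?P2" for i a b
    unfolding G_page_def using tri_pos_less that by (intro graft_copy) auto
  have l2: "(196 * fork_pos c A6 + a, 196 * fork_pos c A6 + b) \<in> ?P2" if "(a, b) \<in> ?P1" for c a b
    using fork_pos_A6 that by (rule graft_copy)
  have l3: "(14 * fork_pos c A6 + a, 14 * fork_pos c A6 + b) \<in> ?P1" if "(a, b) \<in> planted_fork" for c a b
    using fork_pos_A6 that by (rule graft_copy)
  have b2: "(196 * a, 196 * b) \<in> ?P2" if "(a, b) \<in> planted_fork" for a b
    using that by (rule graft_base)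
  have b3: "(14 * a, 14 * b) \<in> ?P1" if "(a, b) \<in> planted_fork" for a b
    using that by (rule graft_base)
  note P = planted_fork_root(2) planted_fork_L
  \<comment> \<open>Link edges start at position 0 of a copy, which is the gluing vertex one level
    up.\<close>
  note z2 = b2[OF planted_fork_root(1), unfolded mult_0_right]
  note z3 = b3[OF planted_fork_root(1), unfolded mult_0_right]
  show ?thesis
    using assms
  proof (cases rule: G_edges_cases)
    case (tri i j)
    then have "tri_pos i \<noteq> tri_pos j" by (cases i; cases j) auto
    then have "(2744 * tri_pos i, 2744 * tri_pos j) \<in> G_page"
      unfolding G_page_def using tri_pos_less by (intro graft_base) auto
    with tri show ?thesis by simp
  next
    case (root i)
    show ?thesis using l1[OF z2, of i] root by simp
  next
    case (mid i b)
    show ?thesis using l1[OF l2[OF z3], of i b] mid by simp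
  next
    case (end_root i b d)
    show ?thesis using l1[OF l2[OF l3[OF planted_fork_root(1)]], of i b d] end_root by simp
  next
    case (fork i b)
    show ?thesis using l1[OF b2[OF P(1)]] unfolding fork G_pos.simps .
  next
    case (upper i b x y)
    show ?thesis using l1[OF b2[OF P(2)[OF upper(3)]]] unfolding upper G_pos.simps .
  next
    case (mid_fork i b d)
    show ?thesis using l1[OF l2[OF b3[OF P(1)]]] unfolding mid_fork G_pos.simps .
  next
    case (lower i b d x y)
    show ?thesis using l1[OF l2[OF b3[OF P(2)[OF lower(3)]]]] unfolding lower G_pos.simps .
  next
    case (end_fork i b d e)
    show ?thesis using l1[OF l2[OF l3[OF P(1)]]] unfolding end_fork G_pos.simps G1_pos.simps .
  next
    case (end_L i b d e x y)
    show ?thesis using l1[OF l2[OF l3[OF P(2)[OF end_L(3)]]]] unfolding end_L G_pos.simps G1_pos.simps .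
  qed
qed

section \<open>Injectivity of the positions\<close>

lemma digit_eq_iff:
  fixes K :: nat
  assumes "s < K" "t < K"
  shows "K * q + s = K * r + t \<longleftrightarrow> q = r \<and> s = t"
  using digit_less_digit[OF assms, of q r] digit_less_digit[OF assms(2,1), of r q]
  by (metis linorder_neq_iff)

lemma fork_pos_bounds: "2 \<le> fork_pos b x" "fork_pos b x < 14"
  by (cases b; cases x; simp add: fork_pos_def)+

lemma fork_pos_eq_iff: "fork_pos b x = fork_pos d y \<longleftrightarrow> b = d \<and> x = y"
  by (cases b; cases d; cases x; cases y; simp add: fork_pos_def)

lemma G1_pos_less: "G1_pos v < 14"
  by (cases v) (auto simp: fork_pos_bounds)

lemma G1_pos_ge: "1 \<le> G1_pos v"
  using fork_pos_bounds(1) by (cases v) (auto intro: le_trans[OF _ fork_pos_bounds(1)])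

lemma G1_pos_eq_iff: "G1_pos v = G1_pos w \<longleftrightarrow> v = w"
proof -
  have "fork_pos b x \<noteq> Suc 0" for b x using fork_pos_bounds(1)[of b x] by simp
  then show ?thesis by (cases v; cases w) (auto simp: fork_pos_eq_iff dest: sym)
qed

fun G_digits :: "G_vert \<Rightarrow> nat \<times> nat \<times> nat \<times> nat" where
  "G_digits (Tri i) = (tri_pos i, 0, 0, 0)"
| "G_digits (Branch i X4) = (tri_pos i, 1, 0, 0)"
| "G_digits (Branch i (Upper b x)) = (tri_pos i, fork_pos b x, 0, 0)"
| "G_digits (Branch i (Mid b)) = (tri_pos i, fork_pos b A6, 1, 0)"
| "G_digits (Branch i (Lower b d x)) = (tri_pos i, fork_pos b A6, fork_pos d x, 0)"
| "G_digits (Branch i (End b d v)) = (tri_pos i, fork_pos b A6, fork_pos d A6, G1_pos v)"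

text \<open>Digits 0 and 1 are reserved for the gluing vertex and the root, and fork positions start
  at 2, so vertices of different kinds differ in some digit.\<close>

lemma inj_G_digits: "inj G_digits"
proof (rule injI)
  fix u v assume eq: "G_digits u = G_digits v"
  have "tri_pos i = tri_pos j \<longleftrightarrow> i = j" for i j by (cases i; cases j; simp)
  moreover have "fork_pos b x \<noteq> 0" "0 \<noteq> fork_pos b x" "fork_pos b x \<noteq> Suc 0" "Suc 0 \<noteq> fork_pos b x" for b x
    using fork_pos_bounds(1)[of b x] by auto
  moreover have "G1_pos w \<noteq> 0" "0 \<noteq> G1_pos w" for w using G1_pos_ge[of w] by auto
  ultimately show "u = v" using eq
    by (cases u rule: G_digits.cases; cases v rule: G_digits.cases)
      (simp_all add: fork_pos_eq_iff G1_pos_eq_iff)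
qed

lemma inj_G_pos: "inj G_pos"
proof (rule injI)
  fix u v assume eq: "G_pos u = G_pos v"
  \<comment> \<open>Horner form in base 14 exposes one digit at a time to
    \<open>digit_eq_iff\<close>.\<close>
  define val :: "nat \<times> nat \<times> nat \<times> nat \<Rightarrow> nat" where
    "val = (\<lambda>(i, a, b, c). 14 * (14 * (14 * i + a) + b) + c)"
  have val: "G_pos v = val (G_digits v)" for v
    by (cases v rule: G_digits.cases) (simp_all add: val_def)
  have dig: "\<exists>i a b c. G_digits v = (i, a, b, c) \<and> a < 14 \<and> b < 14 \<and> c < 14" for v
    by (cases v rule: G_digits.cases) (simp_all add: fork_pos_bounds G1_pos_less)
  obtain i a b c where u: "G_digits u = (i, a, b, c)" "a < 14" "b < 14" "c < 14" using dig by blast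
  obtain i' a' b' c' where v: "G_digits v = (i', a', b', c')" "a' < 14" "b' < 14" "c' < 14"
    using dig by blast
  have "14 * (14 * (14 * i + a) + b) + c = 14 * (14 * (14 * i' + a') + b') + c'"
    using eq by (simp only: val u v val_def prod.case)
  then have "G_digits u = G_digits v" using u v by (simp only: digit_eq_iff)
  then show "u = v" using inj_G_digits by (simp add: inj_eq)
qed

lemma finite_G_vert: "finite (UNIV :: G_vert set)"
proof (rule inj_on_finite[OF inj_G_digits])
  have "G_digits v \<in> {..<3} \<times> {..<14} \<times> {..<14} \<times> {..<14}" for v
    by (cases v rule: G_digits.cases) (simp_all add: fork_pos_bounds G1_pos_less tri_pos_less)
  then show "range G_digits \<subseteq> {..<3} \<times> {..<14} \<times> {..<14} \<times> {..<14}" by blast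
qed simp

lemma no_loops_G: "(u, v) \<in> G_edges \<Longrightarrow> u \<noteq> v"
  by (auto simp: G_edges_def G2_edges_def G1_edges_def L_edges_def)

lemma parcs_graph_G: "parcs graph_G = G_edges \<union> G_edges\<inverse>"
  by (simp add: graph_G_def)

lemma G_page_subset: "map_prod G_pos G_pos ` parcs graph_G \<subseteq> G_page"
proof -
  have "sym G_page" using page_G_page by (simp add: page_def)
  then show ?thesis using G_pos_edge by (auto simp: parcs_graph_G dest: symD)
qed

section \<open>Degrees\<close>

lemma pair_graph_G: "pair_graph graph_G"
proof
  show "finite (pverts graph_G)" by (simp add: graph_G_def finite_G_vert)
  show "finite (parcs graph_G)"
    by (rule finite_subset[OF subset_UNIV finite_Prod_UNIV[OF finite_G_vert finite_G_vert]])
  show "symmetric (with_proj graph_G)"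
    by (auto simp: symmetric_def graph_G_def intro: symI)
  show "\<And>e. e \<in> parcs graph_G \<Longrightarrow> fst e \<noteq> snd e"
    using no_loops_G by (force simp: parcs_graph_G)
qed (simp_all add: graph_G_def)

fun L_nbrs :: "L_vert \<Rightarrow> L_vert list" where
  "L_nbrs A1 = [A2, A3]"
| "L_nbrs A2 = [A1, A3, A4]"
| "L_nbrs A3 = [A1, A2, A5]"
| "L_nbrs A4 = [A2, A5, A6]"
| "L_nbrs A5 = [A3, A4, A6]"
| "L_nbrs A6 = [A4, A5]"

text \<open>\<open>prev\<close> and \<open>next\<close> list the outside neighbours of the ends \<open>A1\<close> and \<open>A6\<close> of the copy \<open>emb\<close>.\<close>

definition chain_nbrs :: "(L_vert \<Rightarrow> 'a) \<Rightarrow> 'a list \<Rightarrow> 'a list \<Rightarrow> L_vert \<Rightarrow> 'a list" where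
  "chain_nbrs emb prev next x =
     map emb (L_nbrs x) @ (if x = A1 then prev else if x = A6 then next else [])"

fun G_nbrs :: "G_vert \<Rightarrow> G_vert list" where
  "G_nbrs (Tri i) = Branch i X4 # (case i of T1 \<Rightarrow> [Tri T2, Tri T3] | T2 \<Rightarrow> [Tri T1, Tri T3] | T3 \<Rightarrow> [Tri T1, Tri T2])"
| "G_nbrs (Branch i X4) = [Tri i, Branch i (Upper False A1), Branch i (Upper True A1)]"
| "G_nbrs (Branch i (Upper b x)) =
     chain_nbrs (\<lambda>x. Branch i (Upper b x)) [Branch i X4] [Branch i (Mid b)] x"
| "G_nbrs (Branch i (Mid b)) =
     [Branch i (Upper b A6), Branch i (Lower b False A1), Branch i (Lower b True A1)]"
| "G_nbrs (Branch i (Lower b d x)) =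
     chain_nbrs (\<lambda>x. Branch i (Lower b d x)) [Branch i (Mid b)] [Branch i (End b d W)] x"
| "G_nbrs (Branch i (End b d W)) =
     [Branch i (Lower b d A6), Branch i (End b d (L1 False A1)), Branch i (End b d (L1 True A1))]"
| "G_nbrs (Branch i (End b d (L1 e x))) =
     chain_nbrs (\<lambda>x. Branch i (End b d (L1 e x))) [Branch i (End b d W)] [] x"

lemma L_edges_nbrs:
  assumes "(x, y) \<in> L_edges" shows "y \<in> set (L_nbrs x)" "x \<in> set (L_nbrs y)"
  using assms by (auto simp: L_edges_def)

lemma length_chain_nbrs: "length prev \<le> 1 \<Longrightarrow> length next \<le> 1 \<Longrightarrow> length (chain_nbrs emb prev next x) \<le> 3"
  by (cases x) (auto simp: chain_nbrs_def)

lemma length_G_nbrs: "length (G_nbrs v) \<le> 3"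
  by (cases v rule: G_nbrs.cases) (auto simp: length_chain_nbrs split: tri.split)

lemma chain_nbrs_first: "prev = [p] \<Longrightarrow> p \<in> set (chain_nbrs emb prev next A1)"
  and chain_nbrs_last: "next = [p] \<Longrightarrow> p \<in> set (chain_nbrs emb prev next A6)"
  by (simp_all add: chain_nbrs_def)

lemma chain_nbrs_L_edges:
  assumes "(x, y) \<in> L_edges"
  shows "emb y \<in> set (chain_nbrs emb prev next x)" "emb x \<in> set (chain_nbrs emb prev next y)"
  using L_edges_nbrs[OF assms] by (auto simp: chain_nbrs_def)

text \<open>Both directions are recorded, so these lists of at most three vertices cover every arc
  leaving a vertex and bound its degree.\<close>

lemma G_edges_nbrs:
  assumes "(u, v) \<in> G_edges" shows "v \<in> set (G_nbrs u) \<and> u \<in> set (G_nbrs v)"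
  using assms
proof (cases rule: G_edges_cases)
  case (tri i j)
  then show ?thesis by (cases i; cases j) auto
next
  case (upper i b x y)
  show ?thesis using chain_nbrs_L_edges[OF upper(3), of "\<lambda>x. Branch i (Upper b x)"] upper by simp
next
  case (lower i b d x y)
  show ?thesis using chain_nbrs_L_edges[OF lower(3), of "\<lambda>x. Branch i (Lower b d x)"] lower by simp
next
  case (end_L i b d e x y)
  show ?thesis using chain_nbrs_L_edges[OF end_L(3), of "\<lambda>x. Branch i (End b d (L1 e x))"] end_L by simp
qed (auto simp: chain_nbrs_first chain_nbrs_last)

lemma subcubic_G: "subcubic graph_G"
  unfolding subcubic_def
proof
  fix v
  have "out_arcs (with_proj graph_G) v \<subseteq> Pair v ` set (G_nbrs v)"
    using G_edges_nbrs by (auto simp: out_arcs_def parcs_graph_G)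
  then have "card (out_arcs (with_proj graph_G) v) \<le> card (set (G_nbrs v))"
    by (meson List.finite_set card_image_le card_mono finite_imageI le_trans)
  also have "\<dots> \<le> 3" using card_length length_G_nbrs le_trans by blast
  finally show "out_degree (with_proj graph_G) v \<le> 3" by (simp add: out_degree_def)
qed

section \<open>Colours\<close>

definition near :: "nat \<Rightarrow> G_vert \<Rightarrow> G_vert \<Rightarrow> bool" where
  "near n u v \<longleftrightarrow> (\<exists>k\<le>n. (u, v) \<in> parcs graph_G ^^ k)"

text \<open>The colouring argument only uses that vertices are too close, so upper bounds suffice. A
  power of the arc relation supplies a walk whose cost under unit weights is its length.\<close>

lemma gdist_le:
  assumes "pair_wf_digraph G" "(u, v) \<in> parcs G ^^ k" "u \<in> pverts G"
  shows "gdist G u v \<le> ereal (real k)"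
proof -
  interpret pair_wf_digraph G by fact
  have "\<exists>p. awalk u p v \<and> length p = k"
    using assms(2)
  proof (induction k arbitrary: v)
    case 0
    then show ?case using assms(3) by (auto simp: awalk_Nil_iff)
  next
    case (Suc k)
    then obtain w where "(u, w) \<in> parcs G ^^ k" "(w, v) \<in> parcs G" by auto
    with Suc.IH obtain p where "awalk u p w" "length p = k" by blast
    then have "awalk u (p @ [(w, v)]) v" "length (p @ [(w, v)]) = Suc k"
      using arc_implies_awalk[OF \<open>(w, v) \<in> parcs G\<close>]
      by (auto intro: awalk_appendI[of _ _ w])
    then show ?case by blast
  qed
  then obtain p where p: "awalk u p v" "length p = k" by blast
  have "awalk_cost (\<lambda>_. 1) p = real (length p)" by (induction p) auto
  then show ?thesis using min_cost_le_walk_cost[OF p(1), of "\<lambda>_. 1"] p(2)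
    by (simp add: gdist_def)
qed

lemma near_refl: "near n u u"
  unfolding near_def by (rule exI[of _ 0]) simp

lemma near_arc: "(u, v) \<in> parcs graph_G \<Longrightarrow> near (Suc 0) u v"
  unfolding near_def by (rule exI[of _ 1]) simp

lemma near_mono: "near m u v \<Longrightarrow> m \<le> n \<Longrightarrow> near n u v"
  unfolding near_def using le_trans by blast

lemma near_trans:
  assumes "near m u v" "near n v w" shows "near (m + n) u w"
proof -
  obtain j k where "j \<le> m" "(u, v) \<in> parcs graph_G ^^ j" "k \<le> n" "(v, w) \<in> parcs graph_G ^^ k"
    using assms unfolding near_def by blast
  then have "j + k \<le> m + n" "(u, w) \<in> parcs graph_G ^^ (j + k)" by (auto simp: relpow_add)
  then show ?thesis unfolding near_def by blast
qed

lemma sym_parcs_graph_G: "sym (parcs graph_G)"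
  by (auto simp: parcs_graph_G sym_def)

lemma sym_relpow:
  assumes "sym R" shows "sym (R ^^ k)"
proof (induction k)
  case (Suc k)
  show ?case
  proof (rule symI)
    fix x z assume "(x, z) \<in> R ^^ Suc k"
    then obtain y where "(x, y) \<in> R ^^ k" "(y, z) \<in> R" by auto
    then have "(z, y) \<in> R" "(y, x) \<in> R ^^ k" using assms Suc by (auto dest: symD)
    then show "(z, x) \<in> R ^^ Suc k" by (rule relpow_Suc_I2)
  qed
qed (simp add: sym_def)

lemma near_sym: "near n u v \<Longrightarrow> near n v u"
  unfolding near_def using symD[OF sym_relpow[OF sym_parcs_graph_G]] by blast

fun L_depth :: "L_vert \<Rightarrow> nat" where
  "L_depth A1 = 0" | "L_depth A2 = 1" | "L_depth A3 = 1" | "L_depth A4 = 2" | "L_depth A5 = 2"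
| "L_depth A6 = 3"

definition L_copy :: "(L_vert \<Rightarrow> G_vert) \<Rightarrow> bool" where
  "L_copy emb \<longleftrightarrow> inj emb \<and> (\<forall>(x, y) \<in> L_edges. (emb x, emb y) \<in> G_edges)"

text \<open>Every vertex of \<open>L\<close> lies on one of the paths \<open>A1 A2 A4 A6\<close> and
  \<open>A1 A3 A5 A6\<close> of length 3.\<close>

lemma near_L_copy:
  assumes "L_copy emb"
  shows "near (L_depth x) (emb A1) (emb x)" "near (3 - L_depth x) (emb x) (emb A6)"
proof -
  have e: "near (Suc 0) (emb x) (emb y)" if "(x, y) \<in> L_edges" for x y
    by (rule near_arc) (use assms that in \<open>auto simp: L_copy_def parcs_graph_G\<close>)
  have E: "near (Suc 0) (emb A1) (emb A2)" "near (Suc 0) (emb A1) (emb A3)"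
      "near (Suc 0) (emb A2) (emb A4)" "near (Suc 0) (emb A3) (emb A5)"
      "near (Suc 0) (emb A4) (emb A6)" "near (Suc 0) (emb A5) (emb A6)"
    by (rule e; simp add: L_edges_def)+
  note E2 = near_trans[OF E(1) E(3)] near_trans[OF E(2) E(4)] near_trans[OF E(3) E(5)]
    near_trans[OF E(4) E(6)] near_trans[OF near_trans[OF E(1) E(3)] E(5)]
  show "near (L_depth x) (emb A1) (emb x)" "near (3 - L_depth x) (emb x) (emb A6)"
    using E E2 near_refl by (cases x; simp add: eval_nat_numeral)+
qed

text \<open>The classes of \<open>S = (1, 1, 2, 5)\<close> are the colours \<open>0\<close> to \<open>3\<close>.\<close>

locale coloring =
  fixes f :: "G_vert \<Rightarrow> nat"
  assumes less4: "f v < 4"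
    and edge: "(u, v) \<in> G_edges \<Longrightarrow> f u \<noteq> f v"
    and two: "near 2 u v \<Longrightarrow> u \<noteq> v \<Longrightarrow> f u = 2 \<Longrightarrow> f v \<noteq> 2"
    and three: "near 5 u v \<Longrightarrow> u \<noteq> v \<Longrightarrow> f u = 3 \<Longrightarrow> f v \<noteq> 3"
begin

text \<open>
  Both triangles contain the colour \<open>2\<close>, and \<open>A1\<close>, \<open>A6\<close> is the only pair between them
  at distance greater than \<open>2\<close>.
\<close>

lemma L_without_3:
  assumes L: "L_copy emb" and no3: "\<And>x. f (emb x) \<noteq> 3"
  shows "f (emb A1) = 2" "f (emb A6) = 2"
proof -
  have arc: "(emb x, emb y) \<in> G_edges" if "(x, y) \<in> L_edges" for x y
    using L that by (auto simp: L_copy_def)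
  have n1: "near (Suc 0) (emb x) (emb y)" if "(x, y) \<in> L_edges \<or> (y, x) \<in> L_edges" for x y
    using arc that by (auto intro: near_arc simp: parcs_graph_G)
  have n2: "near 2 (emb x) (emb z)"
    if "(x, y) \<in> L_edges \<or> (y, x) \<in> L_edges" "(y, z) \<in> L_edges \<or> (z, y) \<in> L_edges" for x y z
    using near_trans[OF n1[OF that(1)] n1[OF that(2)]] by (simp add: numeral_2_eq_2)
  have T: "f (emb A1) = 2 \<or> f (emb A2) = 2 \<or> f (emb A3) = 2"
      "f (emb A4) = 2 \<or> f (emb A5) = 2 \<or> f (emb A6) = 2"
  proof -
    have c: "f (emb x) = 0 \<or> f (emb x) = 1 \<or> f (emb x) = 2" for x
      using less4[of "emb x"] no3[of x] by linarith
    have E: "f (emb A1) \<noteq> f (emb A2)" "f (emb A1) \<noteq> f (emb A3)" "f (emb A2) \<noteq> f (emb A3)"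
        "f (emb A4) \<noteq> f (emb A5)" "f (emb A4) \<noteq> f (emb A6)" "f (emb A5) \<noteq> f (emb A6)"
      by (rule edge[OF arc]; simp add: L_edges_def)+
    show "f (emb A1) = 2 \<or> f (emb A2) = 2 \<or> f (emb A3) = 2"
      using c[of A1] c[of A2] c[of A3] E(1-3) by metis
    show "f (emb A4) = 2 \<or> f (emb A5) = 2 \<or> f (emb A6) = 2"
      using c[of A4] c[of A5] c[of A6] E(4-6) by metis
  qed
  have ne: "emb x \<noteq> emb y" if "x \<noteq> y" for x y
    using L that by (auto simp: L_copy_def inj_def)
  have d: "near 2 (emb A1) (emb A4)" "near 2 (emb A1) (emb A5)" "near 2 (emb A2) (emb A4)"
      "near 2 (emb A2) (emb A5)" "near 2 (emb A2) (emb A6)" "near 2 (emb A3) (emb A4)"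
      "near 2 (emb A3) (emb A5)" "near 2 (emb A3) (emb A6)"
    using n2[of A1 A2 A4] n2[of A1 A3 A5] near_mono[OF n1[of A2 A4]] n2[of A2 A3 A5] n2[of A2 A4 A6]
      n2[of A3 A2 A4] near_mono[OF n1[of A3 A5]] n2[of A3 A5 A6]
    by (simp_all add: L_edges_def)
  have "\<not> (f (emb A1) = 2 \<and> f (emb A4) = 2)" "\<not> (f (emb A1) = 2 \<and> f (emb A5) = 2)"
      "\<not> (f (emb A2) = 2 \<and> f (emb A4) = 2)" "\<not> (f (emb A2) = 2 \<and> f (emb A5) = 2)"
      "\<not> (f (emb A2) = 2 \<and> f (emb A6) = 2)" "\<not> (f (emb A3) = 2 \<and> f (emb A4) = 2)"
      "\<not> (f (emb A3) = 2 \<and> f (emb A5) = 2)" "\<not> (f (emb A3) = 2 \<and> f (emb A6) = 2)"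
    using d[THEN two] ne by simp_all
  with T show "f (emb A1) = 2" "f (emb A6) = 2" by blast+
qed

text \<open>Two copies without colour 3 would both start with colour 2, at distance at most 2
  through \<open>r\<close>.\<close>

lemma fork_has_3:
  assumes L: "\<And>b. L_copy (emb b)" and root: "\<And>b. (r, emb b A1) \<in> G_edges"
    and ne: "emb False A1 \<noteq> emb True A1"
  shows "\<exists>b x. f (emb b x) = 3"
proof (rule ccontr)
  assume "\<not> ?thesis"
  then have "f (emb False A1) = 2" "f (emb True A1) = 2" using L_without_3(1)[OF L] by blast+
  moreover have "near 2 (emb False A1) (emb True A1)"
    using near_trans[OF near_sym near_arc, OF near_arc, of r "emb False A1" "emb True A1"] root
    by (simp add: numeral_2_eq_2 parcs_graph_G)
  ultimately show False using two ne by blast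
qed

section \<open>Forcing colour 3 along a branch\<close>

lemma L_copies:
  "L_copy (\<lambda>x. Branch i (Upper b x))" "L_copy (\<lambda>x. Branch i (Lower b d x))"
  "L_copy (\<lambda>x. Branch i (End b d (L1 e x)))"
  unfolding L_copy_def by (auto simp: inj_def G_edges_def G2_edges_def G1_edges_def)

lemma link_arcs:
  "(Tri i, Branch i X4) \<in> G_edges" "(Branch i X4, Branch i (Upper b A1)) \<in> G_edges"
  "(Branch i (Upper b A6), Branch i (Mid b)) \<in> G_edges"
  "(Branch i (Mid b), Branch i (Lower b d A1)) \<in> G_edges"
  "(Branch i (Lower b d A6), Branch i (End b d W)) \<in> G_edges"
  "(Branch i (End b d W), Branch i (End b d (L1 e A1))) \<in> G_edges"
  unfolding G_edges_def G2_edges_def G1_edges_def by auto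

lemma near_links:
  "near 1 (Tri i) (Branch i X4)" "near 1 (Branch i X4) (Branch i (Upper b A1))"
  "near 1 (Branch i (Upper b A6)) (Branch i (Mid b))"
  "near 1 (Branch i (Mid b)) (Branch i (Lower b d A1))"
  "near 1 (Branch i (Lower b d A6)) (Branch i (End b d W))"
  "near 1 (Branch i (End b d W)) (Branch i (End b d (L1 e A1)))"
  using near_arc link_arcs by (auto simp: parcs_graph_G)

lemma L_depth_le: "L_depth x \<le> 3" "x \<noteq> A6 \<Longrightarrow> L_depth x \<le> 2"
  by (cases x; simp)+

lemma End_3: "\<exists>v. near 4 (Branch i (End b d W)) v \<and> v \<in> range (\<lambda>w. Branch i (End b d w)) \<and> f v = 3"
proof -
  obtain e x where ex: "f (Branch i (End b d (L1 e x))) = 3"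
    using fork_has_3[of "\<lambda>e x. Branch i (End b d (L1 e x))", OF L_copies(3) link_arcs(6)] by auto
  have "near 4 (Branch i (End b d W)) (Branch i (End b d (L1 e x)))"
    by (rule near_mono[OF near_trans[OF near_links(6) near_L_copy(1)[OF L_copies(3)]]])
      (use L_depth_le(1)[of x] in simp)
  with ex show ?thesis by blast
qed

lemma Mid_3: "\<exists>v. near 3 (Branch i (Mid b)) v \<and> v \<in> range (\<lambda>(d, x). Branch i (Lower b d x)) \<and> f v = 3"
proof -
  obtain d x where dx: "f (Branch i (Lower b d x)) = 3"
    using fork_has_3[of "\<lambda>d x. Branch i (Lower b d x)", OF L_copies(2) link_arcs(4)] by auto
  \<comment> \<open>A 3 at the last vertex would be one step from the root of an end gadget, hence
    within \<open>1 + 4 = 5\<close> of a 3 there. The other vertices have depth at most 2, which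
    gives \<open>1 + 2 = 3\<close> from \<open>Mid b\<close>.\<close>
  have "x \<noteq> A6"
  proof
    assume "x = A6"
    obtain w where w: "near 4 (Branch i (End b d W)) (Branch i (End b d w))"
        "f (Branch i (End b d w)) = 3"
      using End_3[of i b d] by blast
    have "near 5 (Branch i (Lower b d A6)) (Branch i (End b d w))"
      using near_trans[OF near_links(5) w(1)] by simp
    with w(2) dx \<open>x = A6\<close> three show False by blast
  qed
  have "near 3 (Branch i (Mid b)) (Branch i (Lower b d x))"
    by (rule near_mono[OF near_trans[OF near_links(4) near_L_copy(1)[OF L_copies(2)]]])
      (use L_depth_le(2)[OF \<open>x \<noteq> A6\<close>] in simp)
  with dx show ?thesis by (intro exI[of _ "Branch i (Lower b d x)"]) auto
qed

text \<open>From depth 2 on, \<open>A6\<close> is at most one step away, and the walk over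
  \<open>Mid b\<close> to the 3 below it has length at most \<open>1 + 1 + 3 = 5\<close>.\<close>

lemma Upper_3_depth:
  assumes "f (Branch i (Upper b x)) = 3"
  shows "L_depth x \<le> 1"
proof (rule ccontr)
  assume "\<not> ?thesis"
  then have "3 - L_depth x \<le> 1" by simp
  then have n: "near 1 (Branch i (Upper b x)) (Branch i (Upper b A6))"
    using near_L_copy(2)[OF L_copies(1)] near_mono by blast
  obtain d y where v: "near 3 (Branch i (Mid b)) (Branch i (Lower b d y))" "f (Branch i (Lower b d y)) = 3"
    using Mid_3[of i b] by auto
  have "near 5 (Branch i (Upper b x)) (Branch i (Lower b d y))"
    using near_trans[OF near_trans[OF n near_links(3)] v(1)] by simp
  with v(2) assms three show False by blast
qed

lemma near_X4_Upper_3: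
  assumes "f (Branch i (Upper b x)) = 3"
  shows "near 2 (Branch i X4) (Branch i (Upper b x))"
  by (rule near_mono[OF near_trans[OF near_links(2) near_L_copy(1)[OF L_copies(1)]]])
    (use Upper_3_depth[OF assms] in simp)

text \<open>A 3 in each upper copy would give two within \<open>2 + 2 = 4\<close> through
  \<open>X4\<close>. So one copy has none and starts with colour 2, within 2 of the triangle vertex;
  the 3 in the other copy is within \<open>1 + 2 = 3\<close> of it.\<close>

lemma Tri_less_2: "f (Tri i) < 2"
proof -
  obtain b x where bx: "f (Branch i (Upper b x)) = 3"
    using fork_has_3[of "\<lambda>b x. Branch i (Upper b x)", OF L_copies(1) link_arcs(2)] by auto
  have "f (Branch i (Upper (\<not> b) y)) \<noteq> 3" for y
  proof
    assume y: "f (Branch i (Upper (\<not> b) y)) = 3"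
    have "near 4 (Branch i (Upper b x)) (Branch i (Upper (\<not> b) y))"
      using near_trans[OF near_sym[OF near_X4_Upper_3[OF bx]] near_X4_Upper_3[OF y]] by simp
    then have "near 5 (Branch i (Upper b x)) (Branch i (Upper (\<not> b) y))"
      by (rule near_mono) simp
    with bx y three show False by blast
  qed
  then have "f (Branch i (Upper (\<not> b) A1)) = 2"
    using L_without_3(1)[OF L_copies(1)] by blast
  moreover have "near 2 (Tri i) (Branch i (Upper (\<not> b) A1))"
    using near_trans[OF near_links(1) near_links(2)] by (simp add: numeral_2_eq_2)
  ultimately have "f (Tri i) \<noteq> 2" using two by blast
  moreover have "near 5 (Tri i) (Branch i (Upper b x))"
    using near_trans[OF near_links(1) near_X4_Upper_3[OF bx]] by (rule near_mono) simp
  then have "f (Tri i) \<noteq> 3" using bx three by blast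
  ultimately show ?thesis using less4[of "Tri i"] by linarith
qed

lemma contradiction: False
proof -
  have "f (Tri T1) \<noteq> f (Tri T2)" "f (Tri T2) \<noteq> f (Tri T3)" "f (Tri T1) \<noteq> f (Tri T3)"
    by (rule edge; simp add: G_edges_def)+
  with Tri_less_2[of T1] Tri_less_2[of T2] Tri_less_2[of T3] show False by linarith
qed

end

section \<open>From packing colorings to colour functions\<close>

lemma not_colorable: "\<not> packing_colorable [1, 1, 2, 5] graph_G"
proof
  assume "packing_colorable [1, 1, 2, 5] graph_G"
  then obtain V where V: "packing_coloring [1, 1, 2, 5] graph_G V"
    by (auto simp: packing_colorable_def)
  define f where "f = (\<lambda>v. SOME i. i < 4 \<and> v \<in> V i)"
  have f: "f v < 4 \<and> v \<in> V (f v)" for v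
  proof -
    have "(\<Union>i<length [1, 1, 2, 5 :: nat]. V i) = pverts graph_G"
      using V unfolding packing_coloring_def by blast
    moreover have "length [1, 1, 2, 5 :: nat] = 4" "pverts graph_G = UNIV"
      by (simp_all add: graph_G_def)
    ultimately have "(\<Union>i<4. V i) = UNIV" by metis
    then have "\<exists>i. i < 4 \<and> v \<in> V i" by blast
    then show ?thesis unfolding f_def by (rule someI_ex)
  qed
  \<comment> \<open>A class with entry \<open>n\<close> asks for distance at least
    \<open>n + 1\<close>, so two vertices within \<open>n\<close> cannot share it.\<close>
  have far: "f u \<noteq> f v" if n: "near n u v" "u \<noteq> v" "[1, 1, 2, 5] ! f u = n" for n u v
  proof
    assume eq: "f u = f v"
    interpret pair_graph graph_G by (rule pair_graph_G)
    have "u \<in> V (f u)" "v \<in> V (f u)" using f[of u] f[of v] eq by simp_all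
    moreover have "f u < length [1, 1, 2, 5 :: nat]" using f[of u] by simp
    ultimately have le: "ereal (real (n + 1)) \<le> gdist graph_G u v"
      using V n(2,3) unfolding packing_coloring_def by blast
    obtain k where k: "k \<le> n" "(u, v) \<in> parcs graph_G ^^ k"
      using n(1) by (auto simp: near_def)
    have "u \<in> pverts graph_G" by (simp add: graph_G_def)
    then have "gdist graph_G u v \<le> ereal (real k)"
      by (rule gdist_le[OF pair_wf_digraph k(2)])
    with le have "ereal (real (n + 1)) \<le> ereal (real k)" by (rule order_trans)
    with k(1) show False by simp
  qed
  have "coloring f"
  proof
    show "f v < 4" for v using f by blast
    show "f u \<noteq> f v" if "(u, v) \<in> G_edges" for u v
    proof -
      have "near 1 u v" using that near_arc by (simp add: parcs_graph_G)
      \<comment> \<open>Every entry of the sequence is at least 1, so adjacent vertices are too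
        close for any common class.\<close>
      moreover have "(1 :: nat) \<le> [1, 1, 2, 5] ! f u"
      proof -
        have "f u = 0 \<or> f u = 1 \<or> f u = 2 \<or> f u = 3" using f[of u] by linarith
        then show ?thesis by auto
      qed
      ultimately show ?thesis by (rule far[OF near_mono no_loops_G[OF that] refl])
    qed
    show "f v \<noteq> 2" if "near 2 u v" "u \<noteq> v" "f u = 2" for u v
      using far[OF that(1,2)] that(3) by simp
    show "f v \<noteq> 3" if "near 5 u v" "u \<noteq> v" "f u = 3" for u v
      using far[OF that(1,2)] that(3) by simp
  qed
  then show False by (rule coloring.contradiction)
qed

theorem mainTheorem4:
  shows "pair_graph graph_G \<and> subcubic graph_G \<and> outerplanar graph_G \<and>
    \<not> packing_colorable [1, 1, 2, 5] graph_G"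
proof -
  have "noncrossing (map_prod G_pos G_pos ` parcs graph_G)"
    using page_G_page G_page_subset noncrossing_subset by (auto simp: page_def)
  then have "outerplanar graph_G"
    by (rule outerplanar_if_noncrossing[OF pair_graph_G inj_on_subset[OF inj_G_pos subset_UNIV]])
  then show ?thesis using pair_graph_G subcubic_G not_colorable by simp
qed

end
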